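(* For every complex number $q$ with $|q|<1$, $$\sum_{n\geq 0} F_1(n) q^n=\frac{1}{1-q^2}\,\frac{(q^2;q^2)_\infty^2}{(q;q^2)_\infty^2}-\frac{1+q^2}{(1-q)(1-q^3)},$$ where $F_1(n)$ are the power series coefficients defined by $$\sum_{n\geq 0} F_1(n) q^n=\sum_{k,n\geq 0} \frac{(q^{2n+2};q^2)_k}{(q^{2n+3};q^2)_k}\,q^{2k+3n+1}.$$
   Context: Notation: $q$ is a complex number with $|q|<1$; $(a;q)_0=1$, $(a;q)_n=\prod_{j=0}^{n-1}(1-aq^j)$, $(a;q)_\infty=\prod_{j=0}^\infty(1-aq^j)$ (and the same with $q$ replaced by $q^2$). The double sum runs over all nonnegative integers $k,n$. The integers $F_1(N)$, $N\ge 0$, are the coefficients of the power series in $q$ given by this double sum. *)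

theory Defs
  imports "HOL-Analysis.Analysis"
begin

definition qpoch :: "complex \<Rightarrow> complex \<Rightarrow> nat \<Rightarrow> complex" where
  "qpoch a q n = (\<Prod>j<n. 1 - a * q ^ j)"

definition qpoch_inf :: "complex \<Rightarrow> complex \<Rightarrow> complex" where
  "qpoch_inf a q = (\<Prod>j. 1 - a * q ^ j)"

lemma qpoch_inf_convergent:
  assumes "norm q < 1"
  shows "convergent_prod (\<lambda>j. 1 - a * q ^ j :: complex)"
proof (intro abs_convergent_prod_imp_convergent_prod summable_imp_abs_convergent_prod)
  show "summable (\<lambda>j. norm (1 - a * q ^ j - 1))"
    using assms by (simp add: norm_mult norm_power summable_mult)
qed

definition double_term :: "complex \<Rightarrow> nat \<times> nat \<Rightarrow> complex" where
  "double_term q = (\<lambda>(k, n).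
     qpoch (q ^ (2*n+2)) (q\<^sup>2) k / qpoch (q ^ (2*n+3)) (q\<^sup>2) k * q ^ (2*k + 3*n + 1))"

definition double_sum :: "complex \<Rightarrow> complex" where
  "double_sum q = (\<Sum>\<^sub>\<infinity>p\<in>UNIV. double_term q p)"

(* Existence and uniqueness of these coefficients, and absolute convergence of the
   double series, are proved below (F1_sums, F1_unique, double_term_abs_summable). *)
definition F1 :: "nat \<Rightarrow> int" where
  "F1 = (THE F. \<forall>q::complex. norm q < 1 \<longrightarrow> (\<lambda>N. of_int (F N) * q ^ N) sums double_sum q)"

(* f is given on the unit disc by an integer power series with majorant M *)
definition int_series :: "(complex \<Rightarrow> complex) \<Rightarrow> (real \<Rightarrow> real) \<Rightarrow> (nat \<Rightarrow> int) \<Rightarrow> bool" where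
  "int_series f M a \<longleftrightarrow> (\<forall>q. norm q < 1 \<longrightarrow>
     (\<lambda>N. of_int (a N) * q ^ N) sums f q \<and>
     summable (\<lambda>N. norm (of_int (a N) * q ^ N)) \<and>
     (\<Sum>N. norm (of_int (a N) * q ^ N)) \<le> M (norm q))"

lemma int_series_mult:
  assumes "int_series f M a" "int_series g L b"
  shows "\<exists>c. int_series (\<lambda>q. f q * g q) (\<lambda>r. M r * L r) c"
proof (intro exI[of _ "\<lambda>N. \<Sum>i\<le>N. a i * b (N - i)"], unfold int_series_def, intro allI impI)
  fix q :: complex assume q: "norm q < 1"
  let ?a = "\<lambda>N. of_int (a N) * q ^ N" and ?b = "\<lambda>N. of_int (b N) * q ^ N"
  let ?c = "\<lambda>N. of_int (\<Sum>i\<le>N. a i * b (N - i)) * q ^ N"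
  have A: "?a sums f q" "summable (\<lambda>N. norm (?a N))" "(\<Sum>N. norm (?a N)) \<le> M (norm q)"
    and B: "?b sums g q" "summable (\<lambda>N. norm (?b N))" "(\<Sum>N. norm (?b N)) \<le> L (norm q)"
    using assms q unfolding int_series_def by blast+
  have c: "?c N = (\<Sum>i\<le>N. ?a i * ?b (N - i))" for N
    by (simp add: sum_distrib_right)
      (intro sum.cong refl, simp add: algebra_simps flip: power_add)
  have 1: "?c sums (f q * g q)"
    unfolding c using Cauchy_product_sums[OF A(2) B(2)] A(1) B(1) by (simp add: sums_iff)
  have sm: "(\<lambda>N. \<Sum>i\<le>N. norm (?a i) * norm (?b (N - i))) sums
      ((\<Sum>N. norm (?a N)) * (\<Sum>N. norm (?b N)))"
    by (intro Cauchy_product_sums) (use A B in simp_all)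
  have le: "norm (?c N) \<le> (\<Sum>i\<le>N. norm (?a i) * norm (?b (N - i)))" for N
    unfolding c by (rule order.trans[OF norm_sum]) (simp add: norm_mult)
  have 2: "summable (\<lambda>N. norm (?c N))"
    by (rule summable_comparison_test'[OF sums_summable[OF sm], of 0]) (use le in auto)
  have "(\<Sum>N. norm (?c N)) \<le> (\<Sum>N. \<Sum>i\<le>N. norm (?a i) * norm (?b (N - i)))"
    by (intro suminf_le le 2 sums_summable[OF sm])
  also have "\<dots> = (\<Sum>N. norm (?a N)) * (\<Sum>N. norm (?b N))"
    using sm by (simp add: sums_iff)
  also have "\<dots> \<le> M (norm q) * L (norm q)"
    by (intro mult_mono A(3) B(3) order.trans[OF _ A(3)] suminf_nonneg A(2) B(2)) auto
  finally show "?c sums (f q * g q) \<and> summable (\<lambda>N. norm (?c N)) \<and>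
      (\<Sum>N. norm (?c N)) \<le> M (norm q) * L (norm q)" using 1 2 by blast
qed

lemma int_series_power:
  "int_series (\<lambda>q. q ^ m) (\<lambda>r. r ^ m) (\<lambda>N. if N = m then 1 else 0)"
proof (unfold int_series_def, intro allI impI)
  fix q :: complex assume "norm q < 1"
  have eq: "(\<lambda>N. of_int (if N = m then 1 else 0) * q ^ N) = (\<lambda>N. if N = m then q ^ N else 0)"
    by auto
  have eq': "(\<lambda>N. norm (if N = m then q ^ N else 0)) = (\<lambda>N. if N = m then norm q ^ N else 0)"
    by (auto simp: norm_power)
  show "(\<lambda>N. of_int (if N = m then 1 else 0) * q ^ N) sums (q ^ m) \<and>
     summable (\<lambda>N. norm (of_int (if N = m then 1 else 0) * q ^ N)) \<and>
     (\<Sum>N. norm (of_int (if N = m then 1 else 0) * q ^ N)) \<le> norm q ^ m"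
    using sums_single[of m "\<lambda>N. q ^ N"] sums_single[of m "\<lambda>N. norm q ^ N"]
    unfolding fun_cong[OF eq] eq' by (simp add: sums_iff)
qed

lemma int_series_one_minus_power:
  assumes "m > 0"
  shows "int_series (\<lambda>q. 1 - q ^ m) (\<lambda>r. 1 + r ^ m)
           (\<lambda>N. if N = 0 then 1 else if N = m then -1 else 0)" (is "int_series _ _ ?a")
proof (unfold int_series_def, intro allI impI)
  fix q :: complex assume "norm q < 1"
  have eq: "of_int (?a N) * q ^ N = (if N = 0 then q ^ N else 0) - (if N = m then q ^ N else 0)" for N
    using assms by auto
  have eq': "norm (of_int (?a N) * q ^ N) =
      (if N = 0 then norm q ^ N else 0) + (if N = m then norm q ^ N else 0)" for N
    using assms by (auto simp: norm_power)
  have "(\<lambda>N. of_int (?a N) * q ^ N) sums (q ^ 0 - q ^ m)"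
    unfolding eq by (intro sums_diff sums_single)
  moreover have "(\<lambda>N. norm (of_int (?a N) * q ^ N)) sums (norm q ^ 0 + norm q ^ m)"
    unfolding eq' by (intro sums_add sums_single)
  ultimately show "(\<lambda>N. of_int (?a N) * q ^ N) sums (1 - q ^ m) \<and>
     summable (\<lambda>N. norm (of_int (?a N) * q ^ N)) \<and>
     (\<Sum>N. norm (of_int (?a N) * q ^ N)) \<le> 1 + norm q ^ m"
    by (simp add: sums_iff)
qed

lemma geometric_dvd_sums:
  fixes x :: "'a :: {real_normed_field, banach}"
  assumes "m > 0" "norm x < 1"
  shows "(\<lambda>N. if m dvd N then x ^ N else 0) sums (1 / (1 - x ^ m))"
proof -
  have "norm (x ^ m) < 1"
    using assms by (simp add: norm_power power_less_one_iff)
  from geometric_sums[OF this] have "(\<lambda>i. if m dvd m * i then x ^ (m * i) else 0) sums (1 / (1 - x ^ m))"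
    by (simp add: power_mult)
  then show ?thesis
    by (subst (asm) sums_mono_reindex[of "\<lambda>i. m * i" "\<lambda>N. if m dvd N then x ^ N else 0"])
      (use assms(1) in \<open>auto simp: strict_mono_def\<close>)
qed

lemma int_series_inverse_one_minus_power:
  assumes "m > 0"
  shows "int_series (\<lambda>q. 1 / (1 - q ^ m)) (\<lambda>r. 1 / (1 - r ^ m)) (\<lambda>N. if m dvd N then 1 else 0)"
    (is "int_series _ _ ?a")
proof (unfold int_series_def, intro allI impI)
  fix q :: complex assume q: "norm q < 1"
  have eq: "of_int (?a N) * q ^ N = (if m dvd N then q ^ N else 0)" for N
    by auto
  have eq': "norm (of_int (?a N) * q ^ N) = (if m dvd N then norm q ^ N else 0)" for N
    by (auto simp: norm_power)
  show "(\<lambda>N. of_int (?a N) * q ^ N) sums (1 / (1 - q ^ m)) \<and>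
     summable (\<lambda>N. norm (of_int (?a N) * q ^ N)) \<and>
     (\<Sum>N. norm (of_int (?a N) * q ^ N)) \<le> 1 / (1 - norm q ^ m)"
    using geometric_dvd_sums[OF assms q] geometric_dvd_sums[OF assms, of "norm q"] q
    unfolding eq' unfolding eq by (simp add: sums_iff)
qed

definition majorant :: "real \<Rightarrow> nat \<Rightarrow> real" where
  "majorant r k = (\<Prod>j<k. (1 + r ^ (2*j+2)) / (1 - r ^ (2*j+3)))"

lemma int_series_quotient:
  "\<exists>a. int_series (\<lambda>q. qpoch (q ^ (2*n+2)) (q\<^sup>2) k / qpoch (q ^ (2*n+3)) (q\<^sup>2) k)
     (\<lambda>r. \<Prod>j<k. (1 + r ^ (2*n+2+2*j)) / (1 - r ^ (2*n+3+2*j))) a"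
proof (induction k)
  case 0
  show ?case using int_series_power[of 0] by (auto simp: qpoch_def)
next
  case (Suc k)
  then obtain a where a: "int_series (\<lambda>q. qpoch (q ^ (2*n+2)) (q\<^sup>2) k / qpoch (q ^ (2*n+3)) (q\<^sup>2) k)
     (\<lambda>r. \<Prod>j<k. (1 + r ^ (2*n+2+2*j)) / (1 - r ^ (2*n+3+2*j))) a" by blast
  obtain b where b: "int_series (\<lambda>q. (1 - q ^ (2*n+2+2*k)) * (1 / (1 - q ^ (2*n+3+2*k))))
      (\<lambda>r. (1 + r ^ (2*n+2+2*k)) * (1 / (1 - r ^ (2*n+3+2*k)))) b"
    using int_series_mult[OF int_series_one_minus_power int_series_inverse_one_minus_power,
        of "2*n+2+2*k" "2*n+3+2*k"] by auto
  have eq: "qpoch (q ^ (2*n+2)) (q\<^sup>2) (Suc k) / qpoch (q ^ (2*n+3)) (q\<^sup>2) (Suc k) =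
     qpoch (q ^ (2*n+2)) (q\<^sup>2) k / qpoch (q ^ (2*n+3)) (q\<^sup>2) k *
      ((1 - q ^ (2*n+2+2*k)) * (1 / (1 - q ^ (2*n+3+2*k))))" for q
    unfolding qpoch_def by (simp add: power_add power_mult)
  show ?case
    using int_series_mult[OF a b] unfolding eq by simp
qed

lemma majorant_bound:
  assumes "0 \<le> r" "r < 1"
  shows "(\<Prod>j<k. (1 + r ^ (2*n+2+2*j)) / (1 - r ^ (2*n+3+2*j))) \<le> majorant r k"
  unfolding majorant_def
proof (intro prod_mono conjI)
  fix j
  have p: "r ^ i < 1" if "i > 0" for i
    using assms that by (simp add: power_less_one_iff)
  have d: "r ^ (2*n+2+2*j) \<le> r ^ (2*j+2)" "r ^ (2*n+3+2*j) \<le> r ^ (2*j+3)"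
    by (intro power_decreasing; use assms in simp)+
  show "0 \<le> (1 + r ^ (2*n+2+2*j)) / (1 - r ^ (2*n+3+2*j))"
    using p[of "2*n+3+2*j"] assms(1) by (intro divide_nonneg_nonneg add_nonneg_nonneg) auto
  show "(1 + r ^ (2*n+2+2*j)) / (1 - r ^ (2*n+3+2*j)) \<le> (1 + r ^ (2*j+2)) / (1 - r ^ (2*j+3))"
    using p[of "2*j+3"] d assms(1) by (intro frac_le add_nonneg_nonneg) auto
qed

lemma majorant_nonneg: "0 \<le> r \<Longrightarrow> r < 1 \<Longrightarrow> majorant r k \<ge> 0"
  unfolding majorant_def
  by (intro prod_nonneg ballI divide_nonneg_nonneg add_nonneg_nonneg) (auto simp: power_le_one)

lemma majorant_summable:
  assumes "0 \<le> r" "r < 1"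
  shows "summable (\<lambda>k. majorant r k * r ^ (2*k))"
proof -
  have l: "(\<lambda>k. r ^ (2*k+c)) \<longlonglongrightarrow> 0" for c
  proof -
    have "(\<lambda>k. r ^ c * (r\<^sup>2) ^ k) \<longlonglongrightarrow> r ^ c * 0"
      using assms by (intro tendsto_mult tendsto_const LIMSEQ_power_zero)
        (simp add: power_less_one_iff)
    also have "(\<lambda>k. r ^ c * (r\<^sup>2) ^ k) = (\<lambda>k. r ^ (2*k+c))"
      by (simp only: power_add power_mult mult.commute[of "r ^ c"])
    finally show ?thesis by simp
  qed
  have r2: "r\<^sup>2 < 1" using assms by (simp add: power_less_one_iff)
  have "(\<lambda>k. (1 + r ^ (2*k+2)) / (1 - r ^ (2*k+3)) * r\<^sup>2) \<longlonglongrightarrow> (1 + 0) / (1 - 0) * r\<^sup>2"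
    by (intro tendsto_intros l) simp
  then have "eventually (\<lambda>k. (1 + r ^ (2*k+2)) / (1 - r ^ (2*k+3)) * r\<^sup>2 < (1 + r\<^sup>2) / 2) sequentially"
    by (rule order_tendstoD) (use r2 in simp)
  then obtain K where K: "\<And>k. k \<ge> K \<Longrightarrow> (1 + r ^ (2*k+2)) / (1 - r ^ (2*k+3)) * r\<^sup>2 < (1 + r\<^sup>2) / 2"
    by (auto simp: eventually_sequentially)
  show ?thesis
  proof (rule summable_ratio_test[of "(1 + r\<^sup>2) / 2" K])
    show "(1 + r\<^sup>2) / 2 < 1" using r2 by simp
    fix k assume k: "K \<le> k"
    have nn: "majorant r k * r ^ (2*k) \<ge> 0" for k
      using assms majorant_nonneg by simp
    have "majorant r (Suc k) * r ^ (2 * Suc k) =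
        (1 + r ^ (2*k+2)) / (1 - r ^ (2*k+3)) * r\<^sup>2 * (majorant r k * r ^ (2*k))"
      by (simp add: majorant_def power2_eq_square)
    also have "\<dots> \<le> (1 + r\<^sup>2) / 2 * (majorant r k * r ^ (2*k))"
      by (intro mult_right_mono nn less_imp_le K k)
    finally show "norm (majorant r (Suc k) * r ^ (2 * Suc k)) \<le> (1 + r\<^sup>2) / 2 * norm (majorant r k * r ^ (2*k))"
      using nn[of k] nn[of "Suc k"] by simp
  qed
qed

lemma majorant_summable_on:
  assumes "0 \<le> r" "r < 1"
  shows "(\<lambda>(k, n). majorant r k * r ^ (2*k+3*n+1)) summable_on UNIV"
proof -
  have g: "(\<lambda>n. (r ^ 3) ^ n) summable_on UNIV"
    using assms by (intro summable_nonneg_imp_summable_on summable_geometric)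
      (auto simp: power_less_one_iff)
  have eq: "(\<lambda>n. majorant r k * r ^ (2*k+3*n+1)) = (\<lambda>n. (majorant r k * r ^ (2*k) * r) * (r ^ 3) ^ n)" for k
    by (simp only: power_add power_mult power_one_right) (simp only: mult_ac)
  have "(\<lambda>(k, n). majorant r k * r ^ (2*k+3*n+1)) summable_on (UNIV \<times> UNIV)"
  proof (rule summable_on_SigmaI)
    show "((\<lambda>n. case (k, n) of (k, n) \<Rightarrow> majorant r k * r ^ (2*k+3*n+1)) has_sum
        ((majorant r k * r ^ (2*k) * r) * (\<Sum>\<^sub>\<infinity>n. (r ^ 3) ^ n))) UNIV" for k
      unfolding prod.case eq by (intro has_sum_cmult_right has_sum_infsum g)
    show "(\<lambda>k. (majorant r k * r ^ (2*k) * r) * (\<Sum>\<^sub>\<infinity>n. (r ^ 3) ^ n)) summable_on UNIV"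
      using assms majorant_nonneg
      by (intro summable_on_cmult_left summable_nonneg_imp_summable_on majorant_summable) auto
  qed (use assms majorant_nonneg in auto)
  then show ?thesis by simp
qed

lemma int_series_double_term:
  "\<exists>a. int_series (\<lambda>q. double_term q (k, n)) (\<lambda>r. majorant r k * r ^ (2*k+3*n+1)) a \<and>
       (\<forall>N < 2*k+3*n+1. a N = 0)"
proof -
  let ?f = "\<lambda>q. qpoch (q ^ (2*n+2)) (q\<^sup>2) k / qpoch (q ^ (2*n+3)) (q\<^sup>2) k"
  define e where "e = 2*k+3*n+1"
  from int_series_quotient[of n k]
  obtain a where a: "int_series ?f
      (\<lambda>r. \<Prod>j<k. (1 + r ^ (2*n+2+2*j)) / (1 - r ^ (2*n+3+2*j))) a" by blast
  define b where "b = (\<lambda>N. if N < e then 0 else a (N - e))"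
  have "int_series (\<lambda>q. double_term q (k, n)) (\<lambda>r. majorant r k * r ^ e) b"
  proof (unfold int_series_def, intro allI impI)
    fix q :: complex assume q: "norm q < 1"
    from a q have A: "(\<lambda>N. of_int (a N) * q ^ N) sums ?f q"
      "summable (\<lambda>N. norm (of_int (a N) * q ^ N))"
      "(\<Sum>N. norm (of_int (a N) * q ^ N)) \<le>
         (\<Prod>j<k. (1 + norm q ^ (2*n+2+2*j)) / (1 - norm q ^ (2*n+3+2*j)))"
      unfolding int_series_def by blast+
    have "(\<lambda>N. of_int (a N) * q ^ N * q ^ e) sums (?f q * q ^ e)"
      by (intro sums_mult2 A)
    also have "(\<lambda>N. of_int (a N) * q ^ N * q ^ e) = (\<lambda>N. of_int (b (N + e)) * q ^ (N + e))"
      by (simp add: b_def power_add mult.assoc)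
    finally have "(\<lambda>N. of_int (b N) * q ^ N) sums (?f q * q ^ e + (\<Sum>N<e. of_int (b N) * q ^ N))"
      by (rule iffD1[OF sums_iff_shift[of "\<lambda>N. of_int (b N) * q ^ N"]])
    then have 1: "(\<lambda>N. of_int (b N) * q ^ N) sums double_term q (k, n)"
      by (simp add: b_def double_term_def e_def)
    let ?S = "\<Sum>N. norm (of_int (a N) * q ^ N)"
    have "(\<lambda>N. norm (of_int (a N) * q ^ N) * norm q ^ e) sums (?S * norm q ^ e)"
      by (intro sums_mult2 summable_sums A)
    also have "(\<lambda>N. norm (of_int (a N) * q ^ N) * norm q ^ e) =
        (\<lambda>N. norm (of_int (b (N + e)) * q ^ (N + e)))"
      by (simp add: b_def power_add norm_mult norm_power mult.assoc)
    finally have "(\<lambda>N. norm (of_int (b N) * q ^ N)) sums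
        (?S * norm q ^ e + (\<Sum>N<e. norm (of_int (b N) * q ^ N)))"
      by (rule iffD1[OF sums_iff_shift[of "\<lambda>N. norm (of_int (b N) * q ^ N)"]])
    then have 2: "(\<lambda>N. norm (of_int (b N) * q ^ N)) sums (?S * norm q ^ e)"
      by (simp add: b_def)
    have "?S * norm q ^ e \<le> majorant (norm q) k * norm q ^ e"
      using order.trans[OF A(3) majorant_bound] q by (intro mult_right_mono) auto
    with 1 2 show "(\<lambda>N. of_int (b N) * q ^ N) sums double_term q (k, n) \<and>
       summable (\<lambda>N. norm (of_int (b N) * q ^ N)) \<and>
       (\<Sum>N. norm (of_int (b N) * q ^ N)) \<le> majorant (norm q) k * norm q ^ e"
      by (simp add: sums_iff)
  qed
  then show ?thesis by (auto simp: b_def e_def)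
qed

lemma double_sum_int_series:
  obtains F :: "nat \<Rightarrow> int" where
    "\<And>q. norm q < 1 \<Longrightarrow> (\<lambda>N. of_int (F N) * q ^ N) sums double_sum q"
    "\<And>q. norm q < 1 \<Longrightarrow> (\<lambda>p. norm (double_term q p)) summable_on UNIV"
proof -
  have "\<forall>p. \<exists>a. int_series (\<lambda>q. double_term q p)
      (\<lambda>r. case p of (k, n) \<Rightarrow> majorant r k * r ^ (2*k+3*n+1)) a \<and>
      (\<forall>N < (case p of (k, n) \<Rightarrow> 2*k+3*n+1). a N = 0)"
    using int_series_double_term by (simp add: split_paired_all)
  from choice[OF this] obtain a where a: "\<And>p. int_series (\<lambda>q. double_term q p)
      (\<lambda>r. case p of (k, n) \<Rightarrow> majorant r k * r ^ (2*k+3*n+1)) (a p)"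
    and a0: "\<And>k n N. N < 2*k+3*n+1 \<Longrightarrow> a (k, n) N = 0"
    by fastforce
  define F where "F = (\<lambda>N. \<Sum>p\<in>{..N}\<times>{..N}. a p N)"
  {
    fix q :: complex assume q: "norm q < 1"
    let ?t = "\<lambda>p N. of_int (a p N) * q ^ N"
    have A: "?t p sums double_term q p" "summable (\<lambda>N. norm (?t p N))"
       "(\<Sum>N. norm (?t p N)) \<le> (case p of (k, n) \<Rightarrow> majorant (norm q) k * norm q ^ (2*k+3*n+1))" for p
      using a[of p] q unfolding int_series_def by blast+
    have hs: "(?t p has_sum double_term q p) UNIV" for p
      by (intro norm_summable_imp_has_sum A)
    have le: "norm (\<Sum>N. norm (?t p N)) \<le> (case p of (k, n) \<Rightarrow> majorant (norm q) k * norm q ^ (2*k+3*n+1))" for p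
      using A(3)[of p] suminf_nonneg[OF A(2)[of p]] by simp
    have s0: "(\<lambda>p. norm (\<Sum>N. norm (?t p N))) summable_on UNIV"
      by (rule Infinite_Sum.abs_summable_on_comparison_test'[OF majorant_summable_on[of "norm q"]])
        (use q le in auto)
    then have s1: "(\<lambda>p. \<Sum>N. norm (?t p N)) summable_on UNIV"
      by (rule abs_summable_summable)
    have s2: "(\<lambda>p. norm (double_term q p)) summable_on UNIV"
    proof (rule Infinite_Sum.abs_summable_on_comparison_test'[OF s1])
      show "norm (double_term q p) \<le> (\<Sum>N. norm (?t p N))" for p
        using summable_norm[OF A(2)[of p]] A(1)[of p] by (simp add: sums_iff)
    qed
    have "(\<lambda>(p, N). norm (?t p N)) summable_on (UNIV \<times> UNIV)"
    proof (rule summable_on_SigmaI[OF _ s1])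
      show "((\<lambda>N. case (p, N) of (p, N) \<Rightarrow> norm (?t p N)) has_sum (\<Sum>N. norm (?t p N))) UNIV" for p
        unfolding prod.case
        by (intro norm_summable_imp_has_sum summable_sums) (use A(2)[of p] in auto)
    qed auto
    then have "(\<lambda>x. norm (case x of (p, N) \<Rightarrow> ?t p N)) summable_on (UNIV \<times> UNIV)"
      by (simp add: case_prod_unfold)
    then have sm: "(\<lambda>(p, N). ?t p N) summable_on (UNIV \<times> UNIV)"
      by (rule abs_summable_summable)
    have D: "(double_term q has_sum double_sum q) UNIV"
      unfolding double_sum_def by (intro has_sum_infsum abs_summable_summable[OF s2])
    have "((\<lambda>(p, N). ?t p N) has_sum double_sum q) (UNIV \<times> UNIV)"
      by (rule has_sum_SigmaI[OF _ D sm]) (use hs in auto)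
    then have sw: "((\<lambda>(N, p). ?t p N) has_sum double_sum q) (UNIV \<times> UNIV)"
      by (subst has_sum_swap) (simp add: case_prod_unfold)
    have "((\<lambda>N. of_int (F N) * q ^ N) has_sum double_sum q) UNIV"
    proof (rule has_sum_SigmaD[OF sw])
      fix N
      show "((\<lambda>p. case (N, p) of (N, p) \<Rightarrow> ?t p N) has_sum (of_int (F N) * q ^ N)) UNIV"
      proof (rule has_sum_finite_neutralI[of "{..N}\<times>{..N}"])
        fix p :: "nat \<times> nat" assume p: "p \<in> UNIV - {..N} \<times> {..N}"
        obtain k n where kn: "p = (k, n)" by (cases p)
        from p have "N < 2*k+3*n+1" unfolding kn by auto
        then show "(case (N, p) of (N, p) \<Rightarrow> ?t p N) = 0" using a0 kn by simp
      qed (auto simp: F_def sum_distrib_right)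
    qed
    then have "(\<lambda>N. of_int (F N) * q ^ N) sums double_sum q"
      by (rule has_sum_imp_sums)
    note this s2
  }
  then show ?thesis using that by blast
qed

lemma double_term_abs_summable:
  "norm q < 1 \<Longrightarrow> (\<lambda>p. norm (double_term q p)) summable_on UNIV"
  using double_sum_int_series by metis

lemma int_power_series_unique:
  fixes F G :: "nat \<Rightarrow> int"
  assumes F: "\<And>q::complex. norm q < 1 \<Longrightarrow> (\<lambda>N. of_int (F N) * q ^ N) sums f q"
    and G: "\<And>q::complex. norm q < 1 \<Longrightarrow> (\<lambda>N. of_int (G N) * q ^ N) sums f q"
  shows "F = G"
proof (rule ccontr)
  assume "F \<noteq> G"
  define m where "m = (LEAST n. F n \<noteq> G n)"
  have "\<exists>n. F n \<noteq> G n" using \<open>F \<noteq> G\<close> by (simp add: fun_eq_iff)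
  then have m: "F m \<noteq> G m" unfolding m_def by (rule LeastI_ex)
  have lt: "F i = G i" if "i < m" for i
    using not_less_Least[of i "\<lambda>n. F n \<noteq> G n"] that unfolding m_def by blast
  define d :: "nat \<Rightarrow> complex" where "d = (\<lambda>i. of_int (F (i + m)) - of_int (G (i + m)))"
  have z: "(\<lambda>i. d i * q ^ i) sums 0" if q: "norm q < 1" "q \<noteq> 0" for q
  proof -
    have "(\<lambda>N. of_int (F N) * q ^ N - of_int (G N) * q ^ N) sums (f q - f q)"
      by (intro sums_diff F G q)
    then have "(\<lambda>i. of_int (F (i + m)) * q ^ (i + m) - of_int (G (i + m)) * q ^ (i + m)) sums 0"
      using lt by (subst sums_iff_shift) simp
    then have "(\<lambda>i. q ^ m * (d i * q ^ i)) sums (q ^ m * 0)"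
      by (simp add: d_def algebra_simps power_add)
    then show ?thesis using q(2) by (subst (asm) sums_mult_iff) auto
  qed
  have "((\<lambda>q::complex. 0) \<longlongrightarrow> d 0) (at 0)"
    by (rule powser_limit_0_strong[of 1]) (use z in auto)
  then have "d 0 = 0"
    using tendsto_unique[OF trivial_limit_at tendsto_const] by metis
  with m show False by (simp add: d_def)
qed

lemma F1_sums:
  assumes "norm (q::complex) < 1"
  shows "(\<lambda>N. of_int (F1 N) * q ^ N) sums double_sum q"
proof -
  obtain F :: "nat \<Rightarrow> int" where F:
    "\<And>q. norm q < 1 \<Longrightarrow> (\<lambda>N. of_int (F N) * q ^ N) sums double_sum q"
    using double_sum_int_series by metis
  have "\<forall>q::complex. norm q < 1 \<longrightarrow> (\<lambda>N. of_int (F1 N) * q ^ N) sums double_sum q"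
    unfolding F1_def by (rule theI[of _ F]) (use F int_power_series_unique in blast)+
  with assms show ?thesis by blast
qed

lemma F1_unique:
  assumes "\<And>q::complex. norm q < 1 \<Longrightarrow> (\<lambda>N. of_int (F N) * q ^ N) sums double_sum q"
  shows "F = F1"
  using assms F1_sums by (rule int_power_series_unique)

end

theory Submission
  imports Defs
begin

text \<open>
  Put \<open>Q = q\<^sup>2\<close>.  For fixed \<open>n\<close> the summand depends on \<open>k\<close> through a quotient of Pochhammer
  symbols times \<open>Q\<^sup>k\<close>.  Since the argument equals the base \<open>Q\<close>, the sum over \<open>k\<close> telescopes
  (\<open>qpoch_quotient_sums\<close>).  Its value is
  \<open>q\<^sup>n / (1 - q) * (A n - 1 + q ^ (2*n+1))\<close>, where \<open>A n\<close> is the quotient of \<open>(q ^ (2*n+2); Q)\<^sub>\<infinity>\<close> by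
  \<open>(q ^ (2*n+3); Q)\<^sub>\<infinity>\<close>.

  Up to a factor independent of \<open>n\<close>, \<open>A n\<close> equals \<open>(q\<^sup>3; Q)\<^sub>n / (Q; Q)\<^sub>n\<close>.  So the part of the sum over
  \<open>n\<close> that involves \<open>A n\<close> is an instance of the \<open>q\<close>-binomial theorem (\<open>q_binomial_theorem\<close>, with
  base \<open>Q\<close>, \<open>a = q\<^sup>3\<close> and \<open>z = q\<close>); it yields the infinite product.  The other two parts are
  geometric series in \<open>q\<close> and \<open>q\<^sup>3\<close>; together they give the rational function.
\<close>

section \<open>Finite and infinite Pochhammer symbols\<close>

lemma qpoch_Suc: "qpoch a q (Suc n) = qpoch a q n * (1 - a * q ^ n)"
  by (simp add: qpoch_def)

lemma qpoch_add: "qpoch a q (m + n) = qpoch a q m * qpoch (a * q ^ m) q n"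
  by (induction n) (simp_all add: qpoch_def power_add mult.assoc)

lemma qpoch_nonzero: "(\<And>j. a * q ^ j \<noteq> 1) \<Longrightarrow> qpoch a q n \<noteq> 0"
  by (auto simp: qpoch_def)

lemma qpoch_tendsto:
  assumes "norm q < 1"
  shows "qpoch a q \<longlonglongrightarrow> qpoch_inf a q"
proof -
  have "(\<lambda>n. \<Prod>j\<le>n. 1 - a * q ^ j) \<longlonglongrightarrow> qpoch_inf a q"
    unfolding qpoch_inf_def by (intro convergent_prod_LIMSEQ qpoch_inf_convergent assms)
  then have "(\<lambda>n. qpoch a q (Suc n)) \<longlonglongrightarrow> qpoch_inf a q"
    by (simp add: qpoch_def lessThan_Suc_atMost)
  then show ?thesis
    by (rule LIMSEQ_imp_Suc)
qed

lemma qpoch_inf_nonzero: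
  assumes "norm q < 1" "\<And>j. a * q ^ j \<noteq> 1"
  shows "qpoch_inf a q \<noteq> 0"
  unfolding qpoch_inf_def
  by (rule prodinf_nonzero[OF qpoch_inf_convergent[OF assms(1)]]) (use assms(2) in auto)

lemma qpoch_inf_split:
  assumes "norm q < 1"
  shows "qpoch_inf a q = qpoch a q n * qpoch_inf (a * q ^ n) q"
proof (rule LIMSEQ_unique)
  show "(\<lambda>m. qpoch a q (n + m)) \<longlonglongrightarrow> qpoch_inf a q"
    using LIMSEQ_ignore_initial_segment[OF qpoch_tendsto[OF assms], of a n]
    by (simp add: add.commute)
  show "(\<lambda>m. qpoch a q (n + m)) \<longlonglongrightarrow> qpoch a q n * qpoch_inf (a * q ^ n) q"
    unfolding qpoch_add by (intro tendsto_mult tendsto_const qpoch_tendsto assms)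
qed

lemma power_neq_one:
  fixes q :: complex
  assumes "norm q < 1" "m > 0"
  shows "q ^ m \<noteq> 1"
proof
  assume "q ^ m = 1"
  then have "norm q ^ m = 1"
    by (metis norm_one norm_power)
  moreover have "norm q ^ m < 1"
    using assms by (simp add: power_less_one_iff)
  ultimately show False
    by simp
qed

section \<open>A telescoping series\<close>

text \<open>
  The summand is \<open>T (Suc k) - T k\<close> for \<open>T k = (a;q)\<^sub>k (1 - c q\<^sup>k) / (c q;q)\<^sub>k\<close>, because
  \<open>(1 - a q\<^sup>k) - (1 - c q\<^sup>k) = (c - a) q\<^sup>k\<close>.  Writing the lower parameter as \<open>c * q\<close> and keeping the
  factor \<open>c - a\<close> on the left avoids any division by \<open>q\<close>, so that \<open>q = 0\<close> is not exceptional.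
\<close>

lemma qpoch_quotient_sums:
  assumes q: "norm q < 1" and c: "\<And>j. c * q ^ Suc j \<noteq> 1"
  shows "(\<lambda>k. qpoch a q k / qpoch (c * q) q k * ((c - a) * q ^ k)) sums
           (qpoch_inf a q / qpoch_inf (c * q) q - (1 - c))"
proof -
  define T where "T = (\<lambda>k. qpoch a q k / qpoch (c * q) q k * (1 - c * q ^ k))"
  have c': "c * q * q ^ j \<noteq> 1" for j
    using c[of j] by (simp add: mult.assoc)
  have T_Suc: "T (Suc k) = qpoch a q k / qpoch (c * q) q k * (1 - a * q ^ k)" for k
    using c'[of k] by (simp add: T_def qpoch_Suc mult.assoc)
  have diff: "qpoch a q k / qpoch (c * q) q k * ((c - a) * q ^ k) = T (Suc k) - T k" for k
    unfolding T_Suc unfolding T_def right_diff_distrib[symmetric] by (simp add: left_diff_distrib)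
  have "T \<longlonglongrightarrow> qpoch_inf a q / qpoch_inf (c * q) q * (1 - c * 0)"
    unfolding T_def
    by (intro tendsto_intros qpoch_tendsto qpoch_inf_nonzero c' q LIMSEQ_power_zero)
  then show ?thesis
    using telescope_sums[of T] unfolding diff by (simp add: T_def qpoch_def)
qed

section \<open>The \<open>q\<close>-binomial theorem\<close>

lemma q_binomial_summable:
  assumes q: "norm q < 1" and z: "norm z < 1"
  shows "summable (\<lambda>n. qpoch a q n / qpoch q q n * z ^ n)"
proof -
  have "(\<lambda>n. norm ((1 - a * q ^ n) / (1 - q * q ^ n) * z)) \<longlonglongrightarrow> norm ((1 - a * 0) / (1 - q * 0) * z)"
    by (intro tendsto_intros LIMSEQ_power_zero q) simp
  then have "eventually (\<lambda>n. norm ((1 - a * q ^ n) / (1 - q * q ^ n) * z) < (1 + norm z) / 2) sequentially"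
    by (rule order_tendstoD) (use z in simp)
  then obtain N where N:
    "\<And>n. n \<ge> N \<Longrightarrow> norm ((1 - a * q ^ n) / (1 - q * q ^ n) * z) < (1 + norm z) / 2"
    by (auto simp: eventually_sequentially)
  show ?thesis
  proof (rule summable_ratio_test[of "(1 + norm z) / 2" N])
    show "(1 + norm z) / 2 < 1"
      using z by simp
  next
    fix n assume n: "N \<le> n"
    have "qpoch a q (Suc n) / qpoch q q (Suc n) * z ^ Suc n =
        (1 - a * q ^ n) / (1 - q * q ^ n) * z * (qpoch a q n / qpoch q q n * z ^ n)"
      by (simp add: qpoch_Suc mult_ac)
    also have "norm \<dots> \<le> (1 + norm z) / 2 * norm (qpoch a q n / qpoch q q n * z ^ n)"
      unfolding norm_mult[of _ "qpoch a q n / qpoch q q n * z ^ n"]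
      by (intro mult_right_mono less_imp_le[OF N[OF n]] norm_ge_zero)
    finally show "norm (qpoch a q (Suc n) / qpoch q q (Suc n) * z ^ Suc n)
        \<le> (1 + norm z) / 2 * norm (qpoch a q n / qpoch q q n * z ^ n)" .
  qed
qed

text \<open>
  The series \<open>f z\<close> satisfies \<open>(1 - z) f z = (1 - a z) f (q z)\<close>, by comparison of coefficients.
  Iteration expresses \<open>f z\<close> through \<open>f (z q\<^sup>m)\<close>, and this tends to \<open>f 0 = 1\<close> as \<open>m\<close> grows.
\<close>

theorem q_binomial_theorem:
  assumes q: "norm q < 1" and z: "norm z < 1"
  shows "(\<lambda>n. qpoch a q n / qpoch q q n * z ^ n) sums (qpoch_inf (a * z) q / qpoch_inf z q)"
proof -
  define c where "c = (\<lambda>n. qpoch a q n / qpoch q q n)"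
  define f where "f = (\<lambda>w. \<Sum>n. c n * w ^ n)"
  have c_sums: "(\<lambda>n. c n * w ^ n) sums f w" if "norm w < 1" for w
    using q_binomial_summable[OF q that, of a] unfolding c_def f_def by (rule summable_sums)
  have c_Suc: "c (Suc n) * (1 - q ^ Suc n) = c n * (1 - a * q ^ n)" for n
    using power_neq_one[OF q, of "Suc n"] by (simp add: c_def qpoch_Suc)
  have shrink: "norm (w * q ^ m) < 1" if "norm w < 1" for w m
  proof -
    have "norm (w * q ^ m) \<le> norm w * 1"
      unfolding norm_mult norm_power using q by (intro mult_left_mono power_le_one) auto
    with that show ?thesis by simp
  qed
  have functional: "(1 - w) * f w = (1 - a * w) * f (w * q)" if w: "norm w < 1" for w
  proof -
    have wq: "norm (w * q) < 1"
      using shrink[OF w, of 1] by simp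
    have "(\<lambda>n. c n * w ^ n - c n * (w * q) ^ n) sums (f w - f (w * q))"
      by (intro sums_diff c_sums w wq)
    then have "(\<lambda>n. c (Suc n) * w ^ Suc n - c (Suc n) * (w * q) ^ Suc n) sums (f w - f (w * q))"
      by (subst sums_Suc_iff) simp
    moreover have "c (Suc n) * w ^ Suc n - c (Suc n) * (w * q) ^ Suc n =
        w * (c n * w ^ n - a * (c n * (w * q) ^ n))" for n
    proof -
      have "c (Suc n) * w ^ Suc n - c (Suc n) * (w * q) ^ Suc n =
          c (Suc n) * (1 - q ^ Suc n) * w ^ Suc n"
        by (simp add: power_mult_distrib algebra_simps)
      then show ?thesis
        unfolding c_Suc by (simp add: power_mult_distrib algebra_simps)
    qed
    ultimately have "(\<lambda>n. w * (c n * w ^ n - a * (c n * (w * q) ^ n))) sums (f w - f (w * q))"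
      by simp
    moreover have "(\<lambda>n. w * (c n * w ^ n - a * (c n * (w * q) ^ n))) sums (w * (f w - a * f (w * q)))"
      by (intro sums_mult sums_diff c_sums w wq)
    ultimately have "f w - f (w * q) = w * (f w - a * f (w * q))"
      by (rule sums_unique2)
    then show ?thesis
      by (simp add: algebra_simps)
  qed
  have iterate: "qpoch z q m * f z = qpoch (a * z) q m * f (z * q ^ m)" for m
  proof (induction m)
    case 0
    show ?case by (simp add: qpoch_def)
  next
    case (Suc m)
    have "qpoch z q (Suc m) * f z = (1 - z * q ^ m) * (qpoch z q m * f z)"
      by (simp add: qpoch_Suc)
    also have "\<dots> = qpoch (a * z) q m * ((1 - z * q ^ m) * f (z * q ^ m))"
      unfolding Suc.IH by simp
    also have "\<dots> = qpoch (a * z) q (Suc m) * f (z * q ^ Suc m)"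
      unfolding functional[OF shrink[OF z]] by (simp add: qpoch_Suc mult_ac)
    finally show ?case .
  qed
  have c0: "c 0 = 1" and f0: "f 0 = 1"
    using powser_sums_zero[of c] c_sums[of 0] by (auto simp: c_def qpoch_def intro: sums_unique2)
  have "isCont f 0"
    unfolding f_def by (rule isCont_powser[of c "1/2"]) (use c_sums[of "1/2"] in \<open>auto simp: sums_iff\<close>)
  moreover have "(\<lambda>m. z * q ^ m) \<longlonglongrightarrow> z * 0"
    by (intro tendsto_intros LIMSEQ_power_zero q)
  ultimately have f_lim: "(\<lambda>m. f (z * q ^ m)) \<longlonglongrightarrow> 1"
    using isCont_tendsto_compose[of 0 f "\<lambda>m. z * q ^ m"] f0 by simp
  have "(\<lambda>m. qpoch z q m * f z) \<longlonglongrightarrow> qpoch_inf (a * z) q * 1"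
    unfolding iterate by (intro tendsto_mult qpoch_tendsto q f_lim)
  moreover have "(\<lambda>m. qpoch z q m * f z) \<longlonglongrightarrow> qpoch_inf z q * f z"
    by (intro tendsto_mult tendsto_const qpoch_tendsto q)
  ultimately have "qpoch_inf z q * f z = qpoch_inf (a * z) q"
    using LIMSEQ_unique by fastforce
  moreover have "qpoch_inf z q \<noteq> 0"
    by (rule qpoch_inf_nonzero[OF q]) (metis less_irrefl norm_one shrink[OF z])
  ultimately have "f z = qpoch_inf (a * z) q / qpoch_inf z q"
    by (simp add: field_simps)
  with c_sums[OF z] show ?thesis
    by (simp add: c_def)
qed

section \<open>The two iterated sums\<close>

text \<open>
  Writing \<open>q ^ (2*k+3*n+1)\<close> as \<open>q\<^sup>n * q ^ (2*k+2*n+1)\<close> leaves exactly the power of \<open>q\<close> that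
  telescoping absorbs, up to the factor \<open>1 - q\<close>: with \<open>c = q ^ (2*n+1)\<close> and \<open>a = q ^ (2*n+2)\<close>,
  \<open>(c - a) * (q\<^sup>2)\<^sup>k = (1 - q) * q ^ (2*k+2*n+1)\<close>.
\<close>

lemma double_term_inner_sums:
  assumes q: "norm q < 1"
  shows "(\<lambda>k. double_term q (k, n)) sums
    (q ^ n / (1 - q) * (qpoch_inf (q ^ (2*n+2)) (q\<^sup>2) / qpoch_inf (q ^ (2*n+3)) (q\<^sup>2) - (1 - q ^ (2*n+1))))"
proof -
  have Q: "norm (q\<^sup>2) < 1"
    using q by (simp add: norm_power power_less_one_iff)
  have ne: "q ^ (2*n+1) * (q\<^sup>2) ^ Suc j \<noteq> 1" for j
  proof -
    have "q ^ (2*n+1) * (q\<^sup>2) ^ Suc j = q ^ (2*n+1 + 2 * Suc j)"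
      by (simp only: power_add power_mult)
    then show ?thesis
      using power_neq_one[OF q, of "2*n+1 + 2 * Suc j"] by (simp only:) simp
  qed
  have q1: "1 - q \<noteq> 0"
    using q by auto
  have lower: "q ^ (2*n+1) * q\<^sup>2 = q ^ (2*n+3)"
    by (simp only: flip: power_add) (simp add: numeral_3_eq_3)
  have step: "(q ^ (2*n+1) - q ^ (2*n+2)) * (q\<^sup>2) ^ k = (1 - q) * q ^ (2*k+2*n+1)" for k
    by (simp add: power_add power_mult power2_eq_square algebra_simps)
  have "double_term q (k, n) = q ^ n / (1 - q) *
      (qpoch (q ^ (2*n+2)) (q\<^sup>2) k / qpoch (q ^ (2*n+3)) (q\<^sup>2) k *
        ((q ^ (2*n+1) - q ^ (2*n+2)) * (q\<^sup>2) ^ k))" for k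
  proof -
    have "q ^ (2*k+3*n+1) = q ^ n * q ^ (2*k+2*n+1)"
      by (simp add: add_ac flip: power_add)
    then show ?thesis
      unfolding step using q1 by (simp add: double_term_def)
  qed
  then show ?thesis
    using sums_mult[OF qpoch_quotient_sums[OF Q ne, of "q ^ (2*n+2)"], of "q ^ n / (1 - q)"]
    unfolding lower by simp
qed

text \<open>
  The index \<open>n\<close> is moved from infinite products into finite ones by
  \<open>(x;Q)\<^sub>\<infinity> = (x;Q)\<^sub>n (x Q\<^sup>n;Q)\<^sub>\<infinity>\<close>; the sum is then a \<open>q\<close>-binomial series with base \<open>Q = q\<^sup>2\<close>.
\<close>

lemma qpoch_inf_quotient_sums:
  assumes q: "norm q < 1"
  shows "(\<lambda>n. q ^ n * (qpoch_inf (q ^ (2*n+2)) (q\<^sup>2) / qpoch_inf (q ^ (2*n+3)) (q\<^sup>2))) sums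
    ((1 - q) / (1 - q\<^sup>2) * ((qpoch_inf (q\<^sup>2) (q\<^sup>2))\<^sup>2 / (qpoch_inf q (q\<^sup>2))\<^sup>2))"
proof -
  define Q where "Q = q\<^sup>2"
  have Q: "norm Q < 1"
    using q by (simp add: Q_def norm_power power_less_one_iff)
  have Qpow: "q ^ m * Q ^ j = q ^ (m + 2 * j)" for m j
    by (simp add: Q_def power_add power_mult)
  have ne: "q ^ m * Q ^ j \<noteq> 1" if "m > 0" for m j
    unfolding Qpow using power_neq_one[OF q] that by simp
  have QQ: "Q * Q ^ j \<noteq> 1" for j
    using ne[of 2 j] by (simp add: Q_def)
  have split2: "qpoch_inf Q Q = qpoch Q Q n * qpoch_inf (q ^ (2*n+2)) Q" for n
    using qpoch_inf_split[OF Q, of Q n] Qpow[of 2 n] by (simp add: Q_def add.commute)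
  have split3: "qpoch_inf (q ^ 3) Q = qpoch (q ^ 3) Q n * qpoch_inf (q ^ (2*n+3)) Q" for n
    using qpoch_inf_split[OF Q, of "q ^ 3" n] Qpow[of 3 n] by (simp add: add.commute)
  have n2: "qpoch Q Q n \<noteq> 0" for n
    by (rule qpoch_nonzero) (rule QQ)
  have n3: "qpoch_inf (q ^ (2*n+3)) Q \<noteq> 0" "qpoch (q ^ 3) Q n \<noteq> 0" for n
    by (rule qpoch_inf_nonzero[OF Q] qpoch_nonzero, rule ne, simp)+
  have "qpoch_inf (q ^ (2*n+2)) Q / qpoch_inf (q ^ (2*n+3)) Q =
      qpoch_inf Q Q / qpoch_inf (q ^ 3) Q * (qpoch (q ^ 3) Q n / qpoch Q Q n)" for n
    unfolding split2[of n] split3[of n] using n2[of n] n3[of n] by simp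
  then have eq: "q ^ n * (qpoch_inf (q ^ (2*n+2)) Q / qpoch_inf (q ^ (2*n+3)) Q) =
      qpoch_inf Q Q / qpoch_inf (q ^ 3) Q * (qpoch (q ^ 3) Q n / qpoch Q Q n * q ^ n)" for n
    by simp
  have sums: "(\<lambda>n. q ^ n * (qpoch_inf (q ^ (2*n+2)) Q / qpoch_inf (q ^ (2*n+3)) Q)) sums
      (qpoch_inf Q Q / qpoch_inf (q ^ 3) Q * (qpoch_inf (q ^ 3 * q) Q / qpoch_inf q Q))"
    unfolding eq by (intro sums_mult q_binomial_theorem Q q)
  have q1: "1 - q \<noteq> 0" and Q1: "1 - Q \<noteq> 0"
    using q Q by auto
  have "qpoch_inf (q ^ 3) Q = qpoch_inf q Q / (1 - q)"
    using qpoch_inf_split[OF Q, of q 1] q1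
    by (simp add: qpoch_def Q_def power3_eq_cube power2_eq_square mult.assoc)
  moreover have "qpoch_inf (q ^ 3 * q) Q = qpoch_inf Q Q / (1 - Q)"
    using qpoch_inf_split[OF Q, of Q 1] Q1
    by (simp add: qpoch_def Q_def power3_eq_cube power2_eq_square mult.assoc)
  ultimately have "qpoch_inf Q Q / qpoch_inf (q ^ 3) Q * (qpoch_inf (q ^ 3 * q) Q / qpoch_inf q Q) =
      (1 - q) / (1 - Q) * ((qpoch_inf Q Q)\<^sup>2 / (qpoch_inf q Q)\<^sup>2)"
    by (simp add: power2_eq_square mult_ac)
  with sums show ?thesis
    by (simp add: Q_def)
qed

text \<open>
  Absolute convergence of the double series allows summing over \<open>k\<close> first.
\<close>

lemma double_sum_sums:
  assumes q: "norm q < 1" and inner: "\<And>n. (\<lambda>k. double_term q (k, n)) sums g n"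
  shows "g sums double_sum q"
proof -
  have sm: "double_term q summable_on UNIV"
    by (rule abs_summable_summable[OF double_term_abs_summable[OF q]])
  then have "(double_term q has_sum double_sum q) (UNIV \<times> UNIV)"
    unfolding double_sum_def by (simp add: has_sum_infsum)
  then have swapped: "((\<lambda>(n, k). double_term q (k, n)) has_sum double_sum q) (UNIV \<times> UNIV)"
    by (subst has_sum_swap) simp
  have "(g has_sum double_sum q) UNIV"
  proof (rule has_sum_SigmaD[OF swapped])
    fix n
    have "(\<lambda>k. case (n, k) of (n, k) \<Rightarrow> double_term q (k, n)) summable_on UNIV"
      using summable_on_SigmaD1[of "\<lambda>n k. double_term q (k, n)" UNIV "\<lambda>_. UNIV" n]
        has_sum_imp_summable[OF swapped] by simp
    then have s: "((\<lambda>k. double_term q (k, n)) has_sum (\<Sum>\<^sub>\<infinity>k. double_term q (k, n))) UNIV"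
      by (simp add: has_sum_infsum)
    then have "(\<Sum>\<^sub>\<infinity>k. double_term q (k, n)) = g n"
      using has_sum_imp_sums inner sums_unique2 by blast
    with s show "((\<lambda>k. case (n, k) of (n, k) \<Rightarrow> double_term q (k, n)) has_sum g n) UNIV"
      by simp
  qed
  then show ?thesis
    by (rule has_sum_imp_sums)
qed

section \<open>The generating function\<close>

theorem theorem2p2:
  fixes q :: complex
  assumes "norm q < 1"
  shows "(\<lambda>n. of_int (F1 n) * q ^ n) sums
           (1 / (1 - q\<^sup>2) * ((qpoch_inf (q\<^sup>2) (q\<^sup>2))\<^sup>2 / (qpoch_inf q (q\<^sup>2))\<^sup>2)
            - (1 + q\<^sup>2) / ((1 - q) * (1 - q ^ 3)))"
proof -
  define A where "A = (\<lambda>n. qpoch_inf (q ^ (2*n+2)) (q\<^sup>2) / qpoch_inf (q ^ (2*n+3)) (q\<^sup>2))"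
  define P where "P = (qpoch_inf (q\<^sup>2) (q\<^sup>2))\<^sup>2 / (qpoch_inf q (q\<^sup>2))\<^sup>2"
  have q3: "norm (q ^ 3) < 1"
    using assms by (simp add: norm_power power_less_one_iff)
  have ne: "1 - q \<noteq> 0" "1 - q ^ 3 \<noteq> 0"
    using assms q3 by auto
  have "(\<lambda>n. 1 / (1 - q) * (q ^ n * A n - q ^ n + q * (q ^ 3) ^ n)) sums
      (1 / (1 - q) * ((1 - q) / (1 - q\<^sup>2) * P - 1 / (1 - q) + q * (1 / (1 - q ^ 3))))"
    unfolding A_def P_def
    by (intro sums_mult sums_add sums_diff qpoch_inf_quotient_sums geometric_sums assms q3)
  moreover have "1 / (1 - q) * (q ^ n * A n - q ^ n + q * (q ^ 3) ^ n) =
      q ^ n / (1 - q) * (A n - (1 - q ^ (2*n+1)))" for n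
  proof -
    have "q * (q ^ 3) ^ n = q ^ n * q ^ (2*n+1)"
      by (simp flip: power_mult power_add power_Suc)
    then show ?thesis
      by (simp add: algebra_simps add_divide_distrib diff_divide_distrib)
  qed
  ultimately have "(\<lambda>n. q ^ n / (1 - q) * (A n - (1 - q ^ (2*n+1)))) sums
      (1 / (1 - q) * ((1 - q) / (1 - q\<^sup>2) * P - 1 / (1 - q) + q * (1 / (1 - q ^ 3))))"
    by (simp only:)
  moreover have "(\<lambda>n. q ^ n / (1 - q) * (A n - (1 - q ^ (2*n+1)))) sums double_sum q"
    unfolding A_def by (intro double_sum_sums double_term_inner_sums assms)
  ultimately have "double_sum q =
      1 / (1 - q) * ((1 - q) / (1 - q\<^sup>2) * P - 1 / (1 - q) + q * (1 / (1 - q ^ 3)))"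
    using sums_unique2 by blast
  also have "\<dots> = 1 / (1 - q\<^sup>2) * P + 1 / (1 - q) * (q / (1 - q ^ 3) - 1 / (1 - q))"
    using ne(1) by (simp add: right_diff_distrib distrib_left)
  also have "1 / (1 - q) * (q / (1 - q ^ 3) - 1 / (1 - q)) = - ((1 + q\<^sup>2) / ((1 - q) * (1 - q ^ 3)))"
  proof -
    have "1 / (1 - q) = (1 + q + q\<^sup>2) / (1 - q ^ 3)"
      using ne by (simp add: divide_simps) (simp add: algebra_simps power2_eq_square power3_eq_cube)
    then have "q / (1 - q ^ 3) - 1 / (1 - q) = - ((1 + q\<^sup>2) / (1 - q ^ 3))"
      by (simp add: add_divide_distrib)
    then show ?thesis by simp
  qed
  finally show ?thesis
    using F1_sums[OF assms] by (simp add: P_def)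
qed

end
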